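(* Let $0<q<1$, let $N$ be a non-negative integer, and let $\beta\in\mathbb{C}\setminus\{0\}$ be such that $\beta^2\neq q^{-k}$ for $k=0,1,\ldots,2N-2$. Define $(N+1)\times(N+1)$ lower triangular matrices $L^{\beta}(x)$ and $M^{\beta}(x)$, with rows and columns indexed by $0,1,\dots,N$, by $$L^{\beta}(x)_{m,n} = \frac{1}{(\beta^2 q^{2n};q)_{m-n}}\, C_{m-n}(x;\beta q^n|q), \qquad 0\le n\le m\le N,$$ $$M^{\beta}(x)_{m,n} = \frac{\beta^{m-n} q^{(m-1)(m-n)}}{(\beta^2 q^{m+n-1};q)_{m-n}}\, C_{m-n}(x;\beta^{-1}q^{1-m}|q), \qquad 0\le n\le m\le N,$$ and with entries $0$ for $n>m$. Then $M^{\beta}(x)$ and $L^{\beta}(x)$ are each other's inverse, i.e. $L^{\beta}(x)M^{\beta}(x)=I=M^{\beta}(x)L^{\beta}(x)$, where $I$ is the identity matrix.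
   Context: For $a\in\mathbb{C}$ and $n\in\{0,1,2,\dots\}$, $(a;q)_n=\prod_{j=0}^{n-1}(1-aq^j)$, with $(a;q)_0=1$. For every $\beta\in\mathbb{C}$ and $n\in\{0,1,2,\dots\}$ the continuous $q$-ultraspherical polynomial $C_n(x;\beta|q)$ is the polynomial in $x$ determined by $$C_n(x;\beta|q)=\sum_{k=0}^{n}\frac{(\beta;q)_k(\beta;q)_{n-k}}{(q;q)_k(q;q)_{n-k}}\,e^{i(n-2k)\theta},\qquad x=\cos\theta.$$ For $N=0$ the condition on $\beta^2$ is empty. *)

theory Defs
  imports
    "HOL-Analysis.Complex_Transcendental"
    "HOL-Computational_Algebra.Polynomial"
    "Jordan_Normal_Form.Matrix"
begin

definition q_poch :: "complex \<Rightarrow> complex \<Rightarrow> nat \<Rightarrow> complex" where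
  "q_poch a q n = (\<Prod>j<n. 1 - a * q ^ j)"

definition q_ultraspherical_sum :: "nat \<Rightarrow> complex \<Rightarrow> complex \<Rightarrow> complex \<Rightarrow> complex" where
  "q_ultraspherical_sum n \<beta> q \<theta> =
     (\<Sum>k=0..n. (q_poch \<beta> q k * q_poch \<beta> q (n - k)) / (q_poch q q k * q_poch q q (n - k))
        * exp (\<i> * (of_nat n - 2 * of_nat k) * \<theta>))"

text \<open>
  The angle ranges over all complex numbers; the polynomial is already determined by the real
  angles. Existence and uniqueness are shown in \<open>q_ultraspherical_poly_ex1\<close> below.
\<close>

definition q_ultraspherical_poly :: "nat \<Rightarrow> complex \<Rightarrow> complex \<Rightarrow> complex poly" where
  "q_ultraspherical_poly n \<beta> q =
     (THE p. \<forall>\<theta>::complex. poly p (cos \<theta>) = q_ultraspherical_sum n \<beta> q \<theta>)"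

definition q_ultraspherical :: "nat \<Rightarrow> complex \<Rightarrow> complex \<Rightarrow> complex \<Rightarrow> complex" where
  "q_ultraspherical n x \<beta> q = poly (q_ultraspherical_poly n \<beta> q) x"

text \<open>
  Exponents of \<open>q\<close> that can be negative are integer powers: \<open>1 - m\<close> always, and
  \<open>m + n - 1\<close> for \<open>m = n = 0\<close>.
\<close>

definition L_mat :: "nat \<Rightarrow> complex \<Rightarrow> complex \<Rightarrow> complex \<Rightarrow> complex mat" where
  "L_mat N \<beta> q x = Matrix.mat (N + 1) (N + 1) (\<lambda>(m, n).
     if n \<le> m
     then 1 / q_poch (\<beta>\<^sup>2 * q ^ (2 * n)) q (m - n) * q_ultraspherical (m - n) x (\<beta> * q ^ n) q
     else 0)"

definition M_mat :: "nat \<Rightarrow> complex \<Rightarrow> complex \<Rightarrow> complex \<Rightarrow> complex mat" where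
  "M_mat N \<beta> q x = Matrix.mat (N + 1) (N + 1) (\<lambda>(m, n).
     if n \<le> m
     then \<beta> ^ (m - n) * q powi ((int m - 1) * (int m - int n))
            / q_poch (\<beta>\<^sup>2 * q powi (int m + int n - 1)) q (m - n)
            * q_ultraspherical (m - n) x (inverse \<beta> * q powi (1 - int m)) q
     else 0)"

lemma cos_of_nat_mult_poly:
  "\<exists>p :: complex poly. \<forall>\<theta>. poly p (cos \<theta>) = cos (of_nat j * \<theta>)"
proof (induction j rule: less_induct)
  case (less j)
  consider "j = 0" | "j = 1" | i where "j = Suc (Suc i)"
    by (metis One_nat_def not0_implies_Suc)
  then show ?case
  proof cases
    case 1
    then show ?thesis by (intro exI[of _ 1]) simp
  next
    case 2
    then show ?thesis by (intro exI[of _ "[:0, 1:]"]) simp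
  next
    case 3
    obtain p1 :: "complex poly" where p1: "\<And>\<theta>. poly p1 (cos \<theta>) = cos (of_nat (Suc i) * \<theta>)"
      using less[of "Suc i"] 3 by auto
    obtain p0 :: "complex poly" where p0: "\<And>\<theta>. poly p0 (cos \<theta>) = cos (of_nat i * \<theta>)"
      using less[of i] 3 by auto
    have "poly ([:0, 2:] * p1 - p0) (cos \<theta>) = cos (of_nat j * \<theta>)" for \<theta> :: complex
    proof -
      have "cos (of_nat j * \<theta>) = cos (of_nat (Suc i) * \<theta> + \<theta>)"
        using 3 by (simp add: algebra_simps)
      moreover have "cos (of_nat i * \<theta>) = cos (of_nat (Suc i) * \<theta> - \<theta>)"
        by (simp add: algebra_simps)
      ultimately show ?thesis
        by (simp only: poly_diff poly_mult p0 p1 cos_add cos_diff) simp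
    qed
    then show ?thesis by blast
  qed
qed

lemma q_ultraspherical_sum_eq_cos:
  "q_ultraspherical_sum n \<beta> q \<theta> =
     (\<Sum>k=0..n. (q_poch \<beta> q k * q_poch \<beta> q (n - k)) / (q_poch q q k * q_poch q q (n - k))
        * cos ((of_nat n - 2 * of_nat k) * \<theta>))"
proof -
  define c where "c k = (q_poch \<beta> q k * q_poch \<beta> q (n - k)) / (q_poch q q k * q_poch q q (n - k))"
    for k
  define e where "e k = exp (\<i> * (of_nat n - 2 * of_nat k) * \<theta>)" for k
  have S: "q_ultraspherical_sum n \<beta> q \<theta> = (\<Sum>k=0..n. c k * e k)"
    by (simp add: q_ultraspherical_sum_def c_def e_def)
  have "(\<Sum>k=0..n. c k * e k) = (\<Sum>k=0..n. c (n - k) * e (n - k))"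
    by (subst sum.atLeastAtMost_rev) simp
  also have "\<dots> = (\<Sum>k=0..n. c k * e (n - k))"
    by (rule sum.cong) (auto simp: c_def mult.commute)
  finally have R: "(\<Sum>k=0..n. c k * e k) = (\<Sum>k=0..n. c k * e (n - k))" .
  have "(\<Sum>k=0..n. c k * cos ((of_nat n - 2 * of_nat k) * \<theta>))
      = (\<Sum>k=0..n. (c k * e k + c k * e (n - k)) / 2)"
  proof (rule sum.cong)
    fix k assume "k \<in> {0..n}"
    then have "e (n - k) = exp (- (\<i> * ((of_nat n - 2 * of_nat k) * \<theta>)))"
      by (auto simp: e_def of_nat_diff algebra_simps)
    then show "c k * cos ((of_nat n - 2 * of_nat k) * \<theta>) = (c k * e k + c k * e (n - k)) / 2"
      by (simp add: cos_exp_eq e_def algebra_simps)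
  qed simp
  also have "\<dots> = (\<Sum>k=0..n. c k * e k)"
    by (simp add: sum_divide_distrib[symmetric] sum.distrib R[symmetric])
  finally show ?thesis using S by (simp add: c_def)
qed

theorem q_ultraspherical_poly_ex1:
  "\<exists>!p. \<forall>\<theta>::complex. poly p (cos \<theta>) = q_ultraspherical_sum n \<beta> q \<theta>"
proof (rule ex_ex1I)
  have "\<exists>p :: complex poly. \<forall>\<theta>. poly p (cos \<theta>) = cos ((of_nat n - 2 * of_nat k) * \<theta>)" for k
  proof (cases "2 * k \<le> n")
    case True
    then show ?thesis
      using cos_of_nat_mult_poly[of "n - 2 * k"] by (simp add: of_nat_diff)
  next
    case False
    obtain p :: "complex poly" where p: "\<And>\<theta>. poly p (cos \<theta>) = cos (of_nat (2 * k - n) * \<theta>)"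
      using cos_of_nat_mult_poly by blast
    have "cos (of_nat (2 * k - n) * \<theta>) = cos ((of_nat n - 2 * of_nat k) * \<theta>)" for \<theta> :: complex
    proof -
      have "of_nat (2 * k - n) * \<theta> = - ((of_nat n - 2 * of_nat k) * \<theta>)"
        using False by (simp add: of_nat_diff algebra_simps)
      then show ?thesis by (simp only: cos_minus)
    qed
    with p show ?thesis by auto
  qed
  then obtain P :: "nat \<Rightarrow> complex poly"
    where P: "\<And>k \<theta>. poly (P k) (cos \<theta>) = cos ((of_nat n - 2 * of_nat k) * \<theta>)"
    by metis
  show "\<exists>p. \<forall>\<theta>::complex. poly p (cos \<theta>) = q_ultraspherical_sum n \<beta> q \<theta>"
    by (rule exI[of _ "\<Sum>k=0..n. Polynomial.smult ((q_poch \<beta> q k * q_poch \<beta> q (n - k))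
          / (q_poch q q k * q_poch q q (n - k))) (P k)"])
      (simp add: q_ultraspherical_sum_eq_cos poly_sum P)
next
  fix p p' :: "complex poly"
  assume p: "\<forall>\<theta>. poly p (cos \<theta>) = q_ultraspherical_sum n \<beta> q \<theta>"
    and p': "\<forall>\<theta>. poly p' (cos \<theta>) = q_ultraspherical_sum n \<beta> q \<theta>"
  have zero: "poly (p - p') (of_real t) = 0" if "t \<in> {-1..1}" for t :: real
  proof -
    have "cos (complex_of_real (arccos t)) = of_real t"
      using that by (simp add: cos_of_real cos_arccos)
    then show ?thesis using p p' by (metis poly_diff right_minus_eq)
  qed
  have "complex_of_real ` {-1..1} \<subseteq> {z. poly (p - p') z = 0}"
    using zero by auto
  moreover have "infinite (complex_of_real ` {-1..1})"
    by (subst finite_image_iff) (auto intro: inj_onI simp: infinite_Icc)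
  ultimately have "p - p' = 0"
    using poly_roots_finite finite_subset by blast
  then show "p = p'" by simp
qed

lemma poly_q_ultraspherical_poly:
  "poly (q_ultraspherical_poly n \<beta> q) (cos \<theta>) = q_ultraspherical_sum n \<beta> q \<theta>"
  using theI'[OF q_ultraspherical_poly_ex1, of n \<beta> q]
  unfolding q_ultraspherical_poly_def by blast

end

theory Submission
  imports
    Defs
    "HOL-Computational_Algebra.Formal_Power_Series"
    "Jordan_Normal_Form.Determinant"
begin

text \<open>
  Both matrices are square, so it is enough to prove that \<open>M L\<close> is the identity. This order is the
  convenient one: in the first column of \<open>M L\<close> the two denominators multiply to a \<open>q\<close>-shifted
  factorial independent of the summation index \<open>k\<close>, with a middle piece left out. Clearing the
  denominators therefore leaves only that piece, a polynomial weight in \<open>q\<^sup>k\<close>. In \<open>L M\<close> a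
  denominator that depends on \<open>k\<close> would remain.

  Deleting the first \<open>n\<close> rows and columns replaces \<open>\<beta>\<close> by \<open>\<beta> q\<^sup>n\<close>, so only the first column of
  \<open>M L\<close> matters. Write \<open>x = (a + b) / 2\<close> with \<open>a b = 1\<close>. In row \<open>n + 1\<close> of this column one has,
  up to a nonzero factor, the sum over \<open>k + j = n + 1\<close> of
  \<open>(\<beta>\<^sup>2 q\<^sup>k; q)\<^sub>n C\<^sub>k(x; \<beta> | q) (\<beta> q\<^sup>n)\<^sup>j C\<^sub>j(x; 1 / (\<beta> q\<^sup>n) | q)\<close>.
  This is the coefficient of \<open>t\<close> to the power \<open>n + 1\<close> in a product \<open>H\<^sub>n(t) = V\<^sub>n(t) G\<^sub>n(t)\<close>, where
  \<open>V\<^sub>n\<close> is the weighted generating function of the \<open>C\<^sub>k(x; \<beta> | q)\<close> and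
  \<open>G\<^sub>n(t) = (a t, b t; q)\<^sub>\<infinity> / (\<beta> q\<^sup>n a t, \<beta> q\<^sup>n b t; q)\<^sub>\<infinity>\<close>.

  Passing from \<open>n\<close> to \<open>n + 1\<close> turns \<open>V\<^sub>n(t)\<close> into \<open>V\<^sub>n(t) - \<beta>\<^sup>2 q\<^sup>n V\<^sub>n(q t)\<close>, and \<open>G\<^sub>n\<^sub>+\<^sub>1(t)\<close> is a
  quadratic polynomial times \<open>G\<^sub>n(t)\<close> as well as a quadratic polynomial times \<open>G\<^sub>n(q t)\<close>.
  This gives
  \<open>H\<^sub>n\<^sub>+\<^sub>1(t) = (1 - \<beta> q\<^sup>n a t) (1 - \<beta> q\<^sup>n b t) H\<^sub>n(t) - \<beta>\<^sup>2 q\<^sup>n (1 - a t) (1 - b t) H\<^sub>n(q t)\<close>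
  (lemma \<open>weighted_dual_product_rec\<close>) with \<open>H\<^sub>0 = 1\<close>. Its leading terms cancel, so \<open>H\<^sub>n\<close> is a
  polynomial of degree at most \<open>n\<close> (lemma \<open>weighted_dual_product_degree\<close>), and its coefficient
  at \<open>n + 1\<close> vanishes. The infinite products are handled as formal power series, through
  their \<open>q\<close>-binomial expansions.
\<close>

section \<open>Shifted factorials\<close>

lemma q_poch_0 [simp]: "q_poch a q 0 = 1"
  by (simp add: q_poch_def)

lemma q_poch_Suc: "q_poch a q (Suc n) = q_poch a q n * (1 - a * q ^ n)"
  by (simp add: q_poch_def)

lemma q_poch_add: "q_poch a q (m + n) = q_poch a q m * q_poch (a * q ^ m) q n"
  by (induction n) (simp_all add: q_poch_Suc power_add mult.assoc)

section \<open>The q-binomial series\<close>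

definition q_dilate :: "complex \<Rightarrow> complex fps \<Rightarrow> complex fps" where
  "q_dilate q f = f oo (fps_const q * fps_X)"

lemma fps_nth_q_dilate [simp]: "fps_nth (q_dilate q f) k = q ^ k * fps_nth f k"
  by (simp add: q_dilate_def fps_compose_linear)

lemma q_dilate_mult: "q_dilate q (f * g) = q_dilate q f * q_dilate q g"
  by (simp add: q_dilate_def fps_compose_mult_distrib)

abbreviation linear_factor :: "complex \<Rightarrow> complex fps" where
  "linear_factor c \<equiv> 1 - fps_const c * fps_X"

lemma fps_nth_linear_factor_mult:
  "fps_nth (linear_factor c * f) k = fps_nth f k - (if k = 0 then 0 else c * fps_nth f (k - 1))"
  by (simp add: algebra_simps)

lemma fps_nth_two_linear_factors_mult:
  assumes "k \<ge> 2"
  shows "fps_nth (linear_factor c * linear_factor d * f) k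
    = fps_nth f k - (c + d) * fps_nth f (k - 1) + c * d * fps_nth f (k - 2)"
proof -
  obtain i where k: "k = Suc (Suc i)"
    using assms by (metis One_nat_def Suc_1 Suc_le_D le_simps(3) not_less_eq_eq)
  show ?thesis
    by (simp only: mult.assoc fps_nth_linear_factor_mult k) (simp add: algebra_simps)
qed

text \<open>
  For \<open>\<bar>q\<bar> < 1\<close>, by the \<open>q\<close>-binomial theorem, this is the expansion in \<open>t\<close> of the infinite product
  \<open>(v t; q)\<^sub>\<infinity> / (u t; q)\<^sub>\<infinity>\<close>; all its properties below can be read off from that product.
  Keeping both parameters, instead of normalising \<open>u = 1\<close>, makes shifts of either parameter
  and dilations of \<open>t\<close> instances of the same construction.
\<close>

definition q_binomial_series :: "complex \<Rightarrow> complex \<Rightarrow> complex \<Rightarrow> complex fps" where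
  "q_binomial_series q u v = Abs_fps (\<lambda>k. (\<Prod>j<k. u - v * q ^ j) / q_poch q q k)"

lemma q_binomial_series_nth_0: "fps_nth (q_binomial_series q u v) 0 = 1"
  by (simp add: q_binomial_series_def)

lemma q_binomial_series_dilate:
  "q_dilate q (q_binomial_series q u v) = q_binomial_series q (q * u) (q * v)"
proof (rule fps_ext)
  fix k
  have "(\<Prod>j<k. q * u - q * v * q ^ j) = (\<Prod>j<k. q * (u - v * q ^ j))"
    by (simp add: algebra_simps)
  also have "\<dots> = q ^ k * (\<Prod>j<k. u - v * q ^ j)"
    by (simp add: prod.distrib)
  finally show "fps_nth (q_dilate q (q_binomial_series q u v)) k
      = fps_nth (q_binomial_series q (q * u) (q * v)) k"
    by (simp add: q_binomial_series_def)
qed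

lemma fps_nth_q_binomial_series_scaled:
  "fps_nth (q_binomial_series q (c * a) (c * \<beta> * a)) k = (c * a) ^ k * (q_poch \<beta> q k / q_poch q q k)"
proof -
  have "(\<Prod>j<k. c * a - c * \<beta> * a * q ^ j) = (\<Prod>j<k. c * a * (1 - \<beta> * q ^ j))"
    by (simp add: algebra_simps)
  then show ?thesis
    by (simp add: q_binomial_series_def q_poch_def prod.distrib)
qed

section \<open>Generating functions\<close>

lemma q_ultraspherical_0: "q_ultraspherical 0 x \<beta> q = 1"
  using poly_q_ultraspherical_poly[of 0 \<beta> q "Arccos x"]
  by (simp add: q_ultraspherical_def q_ultraspherical_sum_def)

text \<open>
  The substitution \<open>a = e\<^sup>i\<^sup>\<theta>\<close>, \<open>b = e\<^sup>-\<^sup>i\<^sup>\<theta>\<close> covers every complex argument, because the complex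
  cosine is surjective.
\<close>

lemma ex_reciprocal_pair: "\<exists>a b :: complex. a * b = 1 \<and> x = (a + b) / 2"
proof (intro exI conjI)
  show "exp (\<i> * Arccos x) * exp (- (\<i> * Arccos x)) = 1"
    by (simp flip: exp_add)
  show "x = (exp (\<i> * Arccos x) + exp (- (\<i> * Arccos x))) / 2"
    by (metis cos_Arccos cos_exp_eq)
qed

text \<open>
  The exponential sum that determines the polynomial is the Cauchy product of two
  \<open>q\<close>-binomial series. The scaling factor \<open>c\<close> is needed for the matrix \<open>M\<close>, where
  \<open>c = \<beta> q\<^sup>n\<close> is paired with the parameter \<open>1 / c\<close>.
\<close>

lemma q_ultraspherical_generating_function:
  assumes "a * b = 1"
  shows "fps_nth (q_binomial_series q (c * a) (c * \<beta> * a) * q_binomial_series q (c * b) (c * \<beta> * b)) n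
    = c ^ n * q_ultraspherical n ((a + b) / 2) \<beta> q"
proof -
  define \<theta> where "\<theta> = - \<i> * Ln a"
  have a0: "a \<noteq> 0" and b: "b = inverse a"
    using assms by (auto simp: inverse_unique)
  have ea: "exp (\<i> * \<theta>) = a" using a0 by (simp add: \<theta>_def)
  have eb: "exp (- (\<i> * \<theta>)) = b" using ea b by (simp add: exp_minus)
  have cos: "cos \<theta> = (a + b) / 2" by (simp add: cos_exp_eq ea eb)
  have e: "exp (\<i> * (of_nat n - 2 * of_nat k) * \<theta>) = b ^ k * a ^ (n - k)" if "k \<le> n" for k
  proof -
    have "\<i> * (of_nat n - 2 * of_nat k) * \<theta> = of_nat k * (- (\<i> * \<theta>)) + of_nat (n - k) * (\<i> * \<theta>)"
      using that by (simp add: of_nat_diff algebra_simps)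
    then show ?thesis by (simp only: exp_add exp_of_nat_mult ea eb)
  qed
  have "fps_nth (q_binomial_series q (c * b) (c * \<beta> * b) * q_binomial_series q (c * a) (c * \<beta> * a)) n
      = (\<Sum>k=0..n. c ^ n * ((q_poch \<beta> q k * q_poch \<beta> q (n - k)) / (q_poch q q k * q_poch q q (n - k))
        * exp (\<i> * (of_nat n - 2 * of_nat k) * \<theta>)))"
    unfolding fps_mult_nth fps_nth_q_binomial_series_scaled
  proof (rule sum.cong)
    fix k assume "k \<in> {0..n}"
    then have "c ^ n = c ^ k * c ^ (n - k)" and "k \<le> n" by (auto simp flip: power_add)
    then show "(c * b) ^ k * (q_poch \<beta> q k / q_poch q q k)
        * ((c * a) ^ (n - k) * (q_poch \<beta> q (n - k) / q_poch q q (n - k)))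
      = c ^ n * ((q_poch \<beta> q k * q_poch \<beta> q (n - k)) / (q_poch q q k * q_poch q q (n - k))
        * exp (\<i> * (of_nat n - 2 * of_nat k) * \<theta>))"
      by (simp add: e power_mult_distrib)
  qed simp
  also have "\<dots> = c ^ n * q_ultraspherical n ((a + b) / 2) \<beta> q"
    unfolding q_ultraspherical_def cos[symmetric] poly_q_ultraspherical_poly
    by (simp add: q_ultraspherical_sum_def sum_distrib_left)
  finally show ?thesis by (simp only: mult.commute)
qed

text \<open>
  With \<open>a b = 1\<close> and \<open>x = (a + b) / 2\<close> this is the generating function of the polynomials
  \<open>C\<^sub>k(x; \<beta> | q)\<close>.
\<close>

definition ultraspherical_series :: "complex \<Rightarrow> complex \<Rightarrow> complex \<Rightarrow> complex \<Rightarrow> complex fps" where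
  "ultraspherical_series q a b \<beta> = q_binomial_series q a (\<beta> * a) * q_binomial_series q b (\<beta> * b)"

text \<open>
  With \<open>c = \<beta> q\<^sup>n\<close> this is the generating function of the numbers \<open>c\<^sup>k C\<^sub>k(x; 1/c | q)\<close>, which for
  \<open>k \<le> n + 1\<close> are, up to their denominators, the entries in row \<open>n + 1\<close> of the matrix \<open>M\<close>. The power of \<open>c\<close> is absorbed into the first
  parameter, so that changing \<open>c\<close> to \<open>q c\<close> is a single shift.
\<close>

definition dual_series :: "complex \<Rightarrow> complex \<Rightarrow> complex \<Rightarrow> complex \<Rightarrow> complex fps" where
  "dual_series q a b c = q_binomial_series q (c * a) a * q_binomial_series q (c * b) b"

text \<open>
  The weight is the value at \<open>q\<^sup>k\<close> of the polynomial \<open>(\<beta>\<^sup>2 z; q)\<^sub>n\<close> in \<open>z\<close>. Hence this series is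
  the image of the generating function under the commuting operators that send \<open>f(t)\<close> to
  \<open>f(t) - \<beta>\<^sup>2 q\<^sup>l f(q t)\<close> for \<open>l < n\<close>.
\<close>

definition weighted_series :: "complex \<Rightarrow> complex \<Rightarrow> complex \<Rightarrow> complex \<Rightarrow> nat \<Rightarrow> complex fps" where
  "weighted_series q a b \<beta> n =
     Abs_fps (\<lambda>k. q_poch (\<beta>\<^sup>2 * q ^ k) q n * fps_nth (ultraspherical_series q a b \<beta>) k)"

lemma weighted_series_Suc:
  "weighted_series q a b \<beta> (Suc n)
    = weighted_series q a b \<beta> n - fps_const (\<beta>\<^sup>2 * q ^ n) * q_dilate q (weighted_series q a b \<beta> n)"
  by (rule fps_ext) (simp add: weighted_series_def q_poch_Suc algebra_simps)

section \<open>Functional equations of the series\<close>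

context
  fixes q :: complex
  assumes q_not_root: "\<And>k. q ^ Suc k \<noteq> 1"
begin

lemma q_poch_q_nonzero: "q_poch q q k \<noteq> 0"
  using q_not_root by (auto simp: q_poch_def simp flip: power_Suc)

lemma q_binomial_series_shift_bottom:
  "q_binomial_series q (q * u) v = linear_factor u * q_binomial_series q u v"
proof (rule fps_ext)
  fix k
  show "fps_nth (q_binomial_series q (q * u) v) k
      = fps_nth (linear_factor u * q_binomial_series q u v) k"
  proof (cases k)
    case (Suc i)
    have "(\<Prod>j<Suc i. q * u - v * q ^ j) = (q * u - v) * (\<Prod>j<i. q * (u - v * q ^ j))"
      by (simp add: prod.lessThan_Suc_shift algebra_simps del: prod.lessThan_Suc)
    also have "\<dots> = q ^ i * (q * u - v) * (\<Prod>j<i. u - v * q ^ j)"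
      by (simp add: prod.distrib)
    finally have P: "(\<Prod>j<Suc i. q * u - v * q ^ j) = q ^ i * (q * u - v) * (\<Prod>j<i. u - v * q ^ j)" .
    show ?thesis
      unfolding Suc fps_nth_linear_factor_mult
      using q_not_root[of i] q_poch_q_nonzero[of i]
      by (simp add: q_binomial_series_def P q_poch_Suc del: prod.lessThan_Suc)
         (simp add: field_simps)
  qed (simp add: q_binomial_series_nth_0)
qed

lemma q_binomial_series_shift_top:
  "linear_factor v * q_binomial_series q u (q * v) = q_binomial_series q u v"
proof (rule fps_ext)
  fix k
  show "fps_nth (linear_factor v * q_binomial_series q u (q * v)) k
      = fps_nth (q_binomial_series q u v) k"
  proof (cases k)
    case (Suc i)
    define Q where "Q = (\<Prod>j<i. u - q * v * q ^ j)"
    have right: "(\<Prod>j<Suc i. u - v * q ^ j) = (u - v) * Q"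
      by (simp add: Q_def prod.lessThan_Suc_shift algebra_simps del: prod.lessThan_Suc)
    have left: "(\<Prod>j<Suc i. u - q * v * q ^ j) = Q * (u - q * v * q ^ i)"
      by (simp add: Q_def)
    show ?thesis
      unfolding Suc fps_nth_linear_factor_mult q_binomial_series_def fps_nth_Abs_fps left right q_poch_Suc
        diff_Suc_1 Q_def[symmetric]
      using q_not_root[of i] q_poch_q_nonzero[of i]
      by (simp add: field_simps)
  qed (simp add: q_binomial_series_nth_0)
qed

lemma q_binomial_series_functional_equation:
  "linear_factor u * q_binomial_series q u v = linear_factor v * q_dilate q (q_binomial_series q u v)"
  by (simp only: q_binomial_series_dilate q_binomial_series_shift_top
      flip: q_binomial_series_shift_bottom)

text \<open>
  The functional equations of the two factors combine to \<open>Y(t) = Y(q t)\<close> for their product.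
  Since \<open>q\<close> is not a root of unity, only constant series satisfy this.
\<close>

lemma q_binomial_series_inverse:
  "q_binomial_series q u v * q_binomial_series q v u = 1" (is "?Y = 1")
proof -
  have "linear_factor u * linear_factor v * ?Y
      = (linear_factor u * q_binomial_series q u v) * (linear_factor v * q_binomial_series q v u)"
    by (simp only: ac_simps)
  also have "\<dots> = linear_factor u * linear_factor v * q_dilate q ?Y"
    unfolding q_binomial_series_functional_equation q_dilate_mult by (simp only: ac_simps)
  finally have "linear_factor u * linear_factor v * ?Y
      = linear_factor u * linear_factor v * q_dilate q ?Y" .
  moreover have nz: "linear_factor c \<noteq> 0" for c
  proof
    assume "linear_factor c = 0"
    then have "fps_nth (linear_factor c) 0 = 0" by (simp only: fps_zero_nth)
    then show False by simp
  qed
  ultimately have Y: "?Y = q_dilate q ?Y"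
    using nz[of u] nz[of v] by (simp only: mult_cancel_left mult_eq_0_iff) blast
  show ?thesis
  proof (rule fps_ext)
    fix k
    show "fps_nth ?Y k = fps_nth 1 k"
    proof (cases k)
      case (Suc i)
      have "fps_nth ?Y k = q ^ k * fps_nth ?Y k"
        by (subst Y) (rule fps_nth_q_dilate)
      then show ?thesis using q_not_root[of i] Suc by (metis fps_one_nth mult_cancel_right1 nat.distinct(1))
    qed (simp add: q_binomial_series_nth_0)
  qed
qed

text \<open>
  The infinite product behind the dual series is
  \<open>(a t, b t; q)\<^sub>\<infinity> / (c a t, c b t; q)\<^sub>\<infinity>\<close>. Replacing \<open>c\<close> by \<open>q c\<close> removes the first factor of each
  denominator; it can also be achieved by dilating \<open>t\<close> and restoring the first factor of each
  numerator. The comparison of both descriptions drives the recurrence of the product below.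
\<close>

lemma dual_series_shift:
  "dual_series q a b (q * c) = linear_factor (c * a) * linear_factor (c * b) * dual_series q a b c"
  using q_binomial_series_shift_bottom[of "c * a" a] q_binomial_series_shift_bottom[of "c * b" b]
  by (simp only: dual_series_def mult.assoc mult.commute mult.left_commute)

lemma dual_series_shift_dilate:
  "dual_series q a b (q * c) = linear_factor a * linear_factor b * q_dilate q (dual_series q a b c)"
proof -
  have "linear_factor a * linear_factor b * q_dilate q (dual_series q a b c)
      = (linear_factor a * q_binomial_series q (q * (c * a)) (q * a))
      * (linear_factor b * q_binomial_series q (q * (c * b)) (q * b))"
    by (simp only: dual_series_def q_dilate_mult q_binomial_series_dilate ac_simps)
  also have "\<dots> = dual_series q a b (q * c)"
    by (simp only: q_binomial_series_shift_top dual_series_def mult.assoc)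
  finally show ?thesis ..
qed

section \<open>The product of the weighted and the dual series is a polynomial\<close>

lemma weighted_dual_product_rec:
  fixes a b \<beta> :: complex
  defines "H \<equiv> \<lambda>n. weighted_series q a b \<beta> n * dual_series q a b (\<beta> * q ^ n)"
  shows "H (Suc n) = linear_factor (\<beta> * q ^ n * a) * linear_factor (\<beta> * q ^ n * b) * H n
    - fps_const (\<beta>\<^sup>2 * q ^ n) * (linear_factor a * linear_factor b * q_dilate q (H n))"
proof -
  have c: "\<beta> * q ^ Suc n = q * (\<beta> * q ^ n)" by simp
  have "H (Suc n) = weighted_series q a b \<beta> n * dual_series q a b (q * (\<beta> * q ^ n))
      - fps_const (\<beta>\<^sup>2 * q ^ n) *
        (q_dilate q (weighted_series q a b \<beta> n) * dual_series q a b (q * (\<beta> * q ^ n)))"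
    unfolding H_def c weighted_series_Suc by (simp only: left_diff_distrib mult.assoc)
  also have "weighted_series q a b \<beta> n * dual_series q a b (q * (\<beta> * q ^ n))
      = linear_factor (\<beta> * q ^ n * a) * linear_factor (\<beta> * q ^ n * b) * H n"
    unfolding H_def dual_series_shift by (simp only: ac_simps)
  also have "q_dilate q (weighted_series q a b \<beta> n) * dual_series q a b (q * (\<beta> * q ^ n))
      = linear_factor a * linear_factor b * q_dilate q (H n)"
    unfolding H_def dual_series_shift_dilate q_dilate_mult by (simp only: ac_simps)
  finally show ?thesis .
qed

text \<open>
  The degree of \<open>H\<^sub>n\<close> is at most \<open>n\<close>, although the recurrence multiplies by quadratic factors: if
  \<open>h\<close> is the coefficient of \<open>t\<^sup>n\<close> in \<open>H\<^sub>n\<close>, the first term of the recurrence contributes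
  \<open>\<beta>\<^sup>2 q\<^sup>2\<^sup>n a b h\<close> to the coefficient of \<open>t\<close> to the power \<open>n + 2\<close>, and the second term subtracts
  \<open>\<beta>\<^sup>2 q\<^sup>n a b q\<^sup>n h\<close>, which is the same.
\<close>

lemma weighted_dual_product_degree:
  assumes "n < k"
  shows "fps_nth (weighted_series q a b \<beta> n * dual_series q a b (\<beta> * q ^ n)) k = 0"
  using assms
proof (induction n arbitrary: k)
  case 0
  have "weighted_series q a b \<beta> 0 = ultraspherical_series q a b \<beta>"
    by (rule fps_ext) (simp add: weighted_series_def)
  moreover have "ultraspherical_series q a b \<beta> * dual_series q a b \<beta>
      = (q_binomial_series q a (\<beta> * a) * q_binomial_series q (\<beta> * a) a)
      * (q_binomial_series q b (\<beta> * b) * q_binomial_series q (\<beta> * b) b)"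
    by (simp only: ultraspherical_series_def dual_series_def ac_simps)
  ultimately show ?case
    using 0 by (simp add: q_binomial_series_inverse)
next
  case (Suc n)
  define H where "H = weighted_series q a b \<beta> n * dual_series q a b (\<beta> * q ^ n)"
  have k: "k \<ge> 2" using Suc.prems by simp
  have "fps_nth H k = 0" and "fps_nth H (k - 1) = 0"
    using Suc.IH[of k] Suc.IH[of "k - 1"] Suc.prems by (auto simp: H_def)
  moreover have "k - 2 = n \<or> fps_nth H (k - 2) = 0"
  proof -
    have "k - 2 = n \<or> n < k - 2" using Suc.prems by linarith
    then show ?thesis using Suc.IH[of "k - 2"] by (auto simp: H_def)
  qed
  ultimately show ?case
    unfolding weighted_dual_product_rec H_def[symmetric] fps_sub_nth fps_mult_left_const_nth
      fps_nth_two_linear_factors_mult[OF k] fps_nth_q_dilate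
    by (auto simp: power2_eq_square)
qed

section \<open>The inverse matrices\<close>

text \<open>
  The sum is the coefficient of \<open>t\<close> to the power \<open>n + 1\<close> in the product of the weighted and the
  dual series, one above the degree of this product.
\<close>

lemma q_ultraspherical_convolution_eq_0:
  assumes "\<beta> \<noteq> 0" and "q \<noteq> 0"
  shows "(\<Sum>j=0..Suc n. q_poch (\<beta>\<^sup>2 * q ^ j) q n * q_ultraspherical j x \<beta> q
    * ((\<beta> * q ^ n) ^ (Suc n - j) * q_ultraspherical (Suc n - j) x (inverse (\<beta> * q ^ n)) q)) = 0"
proof -
  obtain a b where ab: "a * b = 1" and x: "x = (a + b) / 2"
    using ex_reciprocal_pair by blast
  define c where "c = \<beta> * q ^ n"
  have c: "c \<noteq> 0" using assms by (simp add: c_def)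
  have F: "fps_nth (ultraspherical_series q a b \<beta>) j = q_ultraspherical j x \<beta> q" for j
    using q_ultraspherical_generating_function[OF ab, where c = 1 and \<beta> = \<beta> and q = q]
    by (simp add: ultraspherical_series_def x)
  have G: "fps_nth (dual_series q a b c) j = c ^ j * q_ultraspherical j x (inverse c) q" for j
    using q_ultraspherical_generating_function[OF ab, where c = c and \<beta> = "inverse c" and q = q] c
    by (simp add: dual_series_def x)
  have "0 = fps_nth (weighted_series q a b \<beta> n * dual_series q a b c) (Suc n)"
    unfolding c_def by (rule weighted_dual_product_degree[symmetric]) simp
  also have "\<dots> = (\<Sum>j=0..Suc n. q_poch (\<beta>\<^sup>2 * q ^ j) q n * q_ultraspherical j x \<beta> q
      * (c ^ (Suc n - j) * q_ultraspherical (Suc n - j) x (inverse c) q))"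
    by (simp only: fps_mult_nth weighted_series_def fps_nth_Abs_fps F G)
  finally show ?thesis by (simp add: c_def)
qed

text \<open>
  The two denominators are the outer pieces of \<open>(\<beta>\<^sup>2; q)\<close> of length \<open>2 n + 1\<close>, cut at \<open>j\<close> and at
  \<open>n + j\<close>. Their product divides the whole, which does not depend on \<open>j\<close>, and the quotient is
  the missing middle piece, the weight of the preceding lemma.
\<close>

lemma q_ultraspherical_inverse_convolution:
  assumes "\<beta> \<noteq> 0" and "q \<noteq> 0" and nz: "q_poch (\<beta>\<^sup>2) q (2 * n + 1) \<noteq> 0"
  shows "(\<Sum>j=0..Suc n.
      (\<beta> * q ^ n) ^ (Suc n - j) / q_poch (\<beta>\<^sup>2 * q ^ (n + j)) q (Suc n - j)
        * q_ultraspherical (Suc n - j) x (inverse (\<beta> * q ^ n)) q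
      * (1 / q_poch (\<beta>\<^sup>2) q j * q_ultraspherical j x \<beta> q)) = 0"
proof -
  define P where "P = q_poch (\<beta>\<^sup>2) q (2 * n + 1)"
  have split: "P = q_poch (\<beta>\<^sup>2) q j * q_poch (\<beta>\<^sup>2 * q ^ j) q n
      * q_poch (\<beta>\<^sup>2 * q ^ (n + j)) q (Suc n - j)" if "j \<le> Suc n" for j
  proof -
    have "2 * n + 1 = (j + n) + (Suc n - j)" using that by simp
    then show ?thesis
      unfolding P_def by (simp only: q_poch_add) (simp add: power_add mult_ac)
  qed
  have "(\<Sum>j=0..Suc n.
      (\<beta> * q ^ n) ^ (Suc n - j) / q_poch (\<beta>\<^sup>2 * q ^ (n + j)) q (Suc n - j)
        * q_ultraspherical (Suc n - j) x (inverse (\<beta> * q ^ n)) q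
      * (1 / q_poch (\<beta>\<^sup>2) q j * q_ultraspherical j x \<beta> q))
    = (\<Sum>j=0..Suc n. q_poch (\<beta>\<^sup>2 * q ^ j) q n * q_ultraspherical j x \<beta> q
    * ((\<beta> * q ^ n) ^ (Suc n - j) * q_ultraspherical (Suc n - j) x (inverse (\<beta> * q ^ n)) q) / P)"
  proof (rule sum.cong)
    fix j assume "j \<in> {0..Suc n}"
    then have s: "P = q_poch (\<beta>\<^sup>2) q j * q_poch (\<beta>\<^sup>2 * q ^ j) q n
      * q_poch (\<beta>\<^sup>2 * q ^ (n + j)) q (Suc n - j)" by (intro split) simp
    have "P \<noteq> 0" using nz by (simp add: P_def)
    then show "(\<beta> * q ^ n) ^ (Suc n - j) / q_poch (\<beta>\<^sup>2 * q ^ (n + j)) q (Suc n - j)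
        * q_ultraspherical (Suc n - j) x (inverse (\<beta> * q ^ n)) q
      * (1 / q_poch (\<beta>\<^sup>2) q j * q_ultraspherical j x \<beta> q)
    = q_poch (\<beta>\<^sup>2 * q ^ j) q n * q_ultraspherical j x \<beta> q
    * ((\<beta> * q ^ n) ^ (Suc n - j) * q_ultraspherical (Suc n - j) x (inverse (\<beta> * q ^ n)) q) / P"
      unfolding s by (simp add: divide_simps)
  qed simp
  also have "\<dots> = 0"
    by (simp only: sum_divide_distrib[symmetric] q_ultraspherical_convolution_eq_0[OF assms(1,2)]) simp
  finally show ?thesis .
qed

text \<open>
  The diagonal entries are \<open>1\<close>. The entry in row \<open>n + d + 1\<close> and column \<open>n\<close> depends on \<open>n\<close> only
  through \<open>\<beta> q\<^sup>n\<close>, because deleting the first \<open>n\<close> rows and columns of either matrix amounts to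
  replacing \<open>\<beta>\<close> by \<open>\<beta> q\<^sup>n\<close>. It is therefore enough to know the first column, which is the
  preceding identity.
\<close>

lemma M_mat_times_L_mat:
  assumes "\<beta> \<noteq> 0" and "q \<noteq> 0" and nz: "\<And>k::nat. k + 2 \<le> 2 * N \<Longrightarrow> \<beta>\<^sup>2 * q ^ k \<noteq> 1"
  shows "M_mat N \<beta> q x * L_mat N \<beta> q x = 1\<^sub>m (N + 1)"
proof (rule eq_matI)
  let ?M = "M_mat N \<beta> q x" and ?L = "L_mat N \<beta> q x"
  fix m n assume "m < dim_row (1\<^sub>m (N + 1))" and "n < dim_col (1\<^sub>m (N + 1))"
  then have mn: "m < N + 1" "n < N + 1" by simp_all
  have entry: "(?M * ?L) $$ (m, n) = (\<Sum>k=0..<N+1. ?M $$ (m, k) * ?L $$ (k, n))"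
    using mn by (simp add: M_mat_def L_mat_def scalar_prod_def)
  have outside: "?M $$ (m, k) * ?L $$ (k, n) = 0" if "k < N + 1" "k \<notin> {n..m}" for k
    using that mn by (auto simp: M_mat_def L_mat_def)
  have entry': "(?M * ?L) $$ (m, n) = (\<Sum>k=n..m. ?M $$ (m, k) * ?L $$ (k, n))"
    unfolding entry by (rule sum.mono_neutral_right) (use mn outside in auto)
  show "(?M * ?L) $$ (m, n) = 1\<^sub>m (N + 1) $$ (m, n)"
  proof (cases "m \<le> n")
    case True
    then show ?thesis
      unfolding entry' using mn
      by (cases "m = n") (simp_all add: M_mat_def L_mat_def q_ultraspherical_0)
  next
    case False
    then obtain d where m: "m = n + Suc d"
      by (metis add_Suc_right less_imp_Suc_add not_le)
    define B where "B = \<beta> * q ^ n"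
    have B2: "B\<^sup>2 = \<beta>\<^sup>2 * q ^ (2 * n)"
      by (simp add: B_def power_mult_distrib power_mult mult.commute)
    \<comment> \<open>The largest exponent of \<open>q\<close> in these factors is \<open>2 n + 2 d = 2 m - 2\<close>, and \<open>m \<le> N\<close>.\<close>
    have "q_poch (B\<^sup>2) q (2 * d + 1) \<noteq> 0"
      using nz[of "2 * n + i" for i] mn
      by (auto simp: q_poch_def B2 m power_add mult.assoc)
    moreover have "B \<noteq> 0" using assms by (simp add: B_def)
    ultimately have zero: "(\<Sum>j=0..Suc d.
      (B * q ^ d) ^ (Suc d - j) / q_poch (B\<^sup>2 * q ^ (d + j)) q (Suc d - j)
        * q_ultraspherical (Suc d - j) x (inverse (B * q ^ d)) q
      * (1 / q_poch (B\<^sup>2) q j * q_ultraspherical j x B q)) = 0"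
      using assms by (intro q_ultraspherical_inverse_convolution)
    have "(?M * ?L) $$ (m, n) = (\<Sum>j=0..Suc d. ?M $$ (m, n + j) * ?L $$ (n + j, n))"
      unfolding entry'
      by (rule sum.reindex_bij_witness[of _ "\<lambda>j. n + j" "\<lambda>k. k - n"]) (auto simp: m)
    also have "\<dots> = (\<Sum>j=0..Suc d.
      (B * q ^ d) ^ (Suc d - j) / q_poch (B\<^sup>2 * q ^ (d + j)) q (Suc d - j)
        * q_ultraspherical (Suc d - j) x (inverse (B * q ^ d)) q
      * (1 / q_poch (B\<^sup>2) q j * q_ultraspherical j x B q))"
    proof (rule sum.cong)
      fix j assume "j \<in> {0..Suc d}"
      then have j: "j \<le> Suc d" by simp
      have p1: "q powi ((int m - 1) * (int m - int (n + j))) = q ^ ((n + d) * (Suc d - j))"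
      proof -
        have "(int m - 1) * (int m - int (n + j)) = int ((n + d) * (Suc d - j))"
          using j by (simp add: m of_nat_diff)
        then show ?thesis by (simp only: power_int_of_nat)
      qed
      have p2: "q powi (int m + int (n + j) - 1) = q ^ (2 * n + (d + j))"
      proof -
        have "int m + int (n + j) - 1 = int (2 * n + (d + j))" by (simp add: m)
        then show ?thesis by (simp only: power_int_of_nat)
      qed
      have p3: "q powi (1 - int m) = inverse (q ^ (n + d))"
      proof -
        have "1 - int m = - int (n + d)" by (simp add: m)
        then show ?thesis by (simp only: power_int_minus power_int_of_nat)
      qed
      have diff: "m - (n + j) = Suc d - j" by (simp add: m)
      have M: "?M $$ (m, n + j) = (B * q ^ d) ^ (Suc d - j) / q_poch (B\<^sup>2 * q ^ (d + j)) q (Suc d - j)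
        * q_ultraspherical (Suc d - j) x (inverse (B * q ^ d)) q"
      proof -
        have 1: "?M $$ (m, n + j) = \<beta> ^ (Suc d - j) * q ^ ((n + d) * (Suc d - j))
            / q_poch (\<beta>\<^sup>2 * q ^ (2 * n + (d + j))) q (Suc d - j)
            * q_ultraspherical (Suc d - j) x (inverse \<beta> * inverse (q ^ (n + d))) q"
        proof -
          have "?M $$ (m, n + j) = \<beta> ^ (m - (n + j)) * q powi ((int m - 1) * (int m - int (n + j)))
              / q_poch (\<beta>\<^sup>2 * q powi (int m + int (n + j) - 1)) q (m - (n + j))
              * q_ultraspherical (m - (n + j)) x (inverse \<beta> * q powi (1 - int m)) q"
            using mn j m by (simp add: M_mat_def)
          then show ?thesis unfolding p1 p2 p3 diff .
        qed
        have 2: "\<beta> ^ (Suc d - j) * q ^ ((n + d) * (Suc d - j)) = (B * q ^ d) ^ (Suc d - j)"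
          by (simp add: B_def power_mult power_add power_mult_distrib mult.assoc)
        have 3: "\<beta>\<^sup>2 * q ^ (2 * n + (d + j)) = B\<^sup>2 * q ^ (d + j)"
          by (simp add: B2 power_add)
        have 4: "inverse \<beta> * inverse (q ^ (n + d)) = inverse (B * q ^ d)"
          by (simp add: B_def power_add mult_ac)
        show ?thesis unfolding 1 2 3 4 ..
      qed
      have L: "?L $$ (n + j, n) = 1 / q_poch (B\<^sup>2) q j * q_ultraspherical j x B q"
        using mn j by (simp add: L_mat_def m B_def[symmetric] B2[symmetric])
      show "?M $$ (m, n + j) * ?L $$ (n + j, n)
        = (B * q ^ d) ^ (Suc d - j) / q_poch (B\<^sup>2 * q ^ (d + j)) q (Suc d - j)
        * q_ultraspherical (Suc d - j) x (inverse (B * q ^ d)) q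
        * (1 / q_poch (B\<^sup>2) q j * q_ultraspherical j x B q)"
        unfolding M L ..
    qed simp
    also have "\<dots> = 0" by (rule zero)
    finally show ?thesis using mn m by simp
  qed
qed (simp_all add: M_mat_def L_mat_def)

end

theorem corollary1p2:
  fixes q :: real and N :: nat and \<beta> x :: complex
  assumes "0 < q" and "q < 1"
    and "\<beta> \<noteq> 0"
    and "\<And>k::nat. int k \<le> 2 * int N - 2 \<Longrightarrow> \<beta>\<^sup>2 \<noteq> complex_of_real q powi (- int k)"
  shows "L_mat N \<beta> (complex_of_real q) x * M_mat N \<beta> (complex_of_real q) x = 1\<^sub>m (N + 1)
    \<and> M_mat N \<beta> (complex_of_real q) x * L_mat N \<beta> (complex_of_real q) x = 1\<^sub>m (N + 1)"
proof -
  let ?q = "complex_of_real q"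
  have not_root: "?q ^ Suc k \<noteq> 1" for k
  proof -
    have "q ^ Suc k < 1" using assms(1,2) by (intro power_Suc_less_one) auto
    then show ?thesis by (metis of_real_eq_1_iff of_real_power order_less_irrefl)
  qed
  have "\<beta>\<^sup>2 * ?q ^ k \<noteq> 1" if "k + 2 \<le> 2 * N" for k
    using assms(4)[of k] that assms(1) by (auto simp: power_int_minus field_simps)
  then have left_inv: "M_mat N \<beta> ?q x * L_mat N \<beta> ?q x = 1\<^sub>m (N + 1)"
    using assms not_root by (intro M_mat_times_L_mat) auto
  have "L_mat N \<beta> ?q x * M_mat N \<beta> ?q x = 1\<^sub>m (N + 1)"
    by (rule mat_mult_left_right_inverse[OF _ _ left_inv]) (simp_all add: L_mat_def M_mat_def)
  with left_inv show ?thesis by blast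
qed

end
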